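(* Let $p=p(n)\in(0,1)$ and let $K_{n,p}$ denote the number of edges of the random symmetric edge polytope $P_{n,p}$. Then $$\mathbb{E}[K_{n,p}]=12\binom{n}{4}p^2(1-p^2)+6\binom{n}{3}p^2\Bigl(1+(1-p)(1-p^2)^{n-3}\Bigr).$$ As $n\to\infty$, this yields $$\mathbb{E}[K_{n,p}]\simeq n^4p^2(1-p)+n^3p^2\simeq\begin{cases} n^3p^2, & \text{if } 1-p\ll n^{-1},\\ n^4p^2(1-p), & \text{if } 1-p\gtrsim n^{-1}.\end{cases}$$ In particular, $\mathbb{E}[K_{n,p}]\to\infty$ if and only if $p\gg n^{-2}$.
   Context: For a finite simple graph $G=(V,E)$ (elements of $V$ are nodes, elements of $E\subseteq\binom V2$ are arcs), with $(\mathbf{e}_i)_{i\in V}$ the standard basis of $\mathbb{R}^V$, the symmetric edge polytope is $P_G:=\operatorname{conv}\{\pm(\mathbf{e}_i-\mathbf{e}_j):\{i,j\}\in E\}\subset\mathbb{R}^V$ (empty if $E=\emptyset$). A face of a polytope is its intersection with a supporting hyperplane; the polytope itself is not regarded as a face. Edges of a polytope are its $1$-dimensional faces (so if $G$ has exactly one arc, $P_G$ has no edges). $G_{n,p}$ is the Erdős–Rényi random graph on node set $[n]$, each arc of the complete graph being retained independently with probability $p=p(n)\in(0,1)$; $P_{n,p}:=P_{G_{n,p}}$. Asymptotic notation for sequences: $a_n\simeq b_n$ means $0<\liminf|a_n/b_n|\le\limsup|a_n/b_n|<\infty$; $a_n\ll b_n$ means $\limsup|a_n/b_n|=0$; $a_n\gg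 b_n$ means $\liminf|a_n/b_n|=\infty$; $a_n\gtrsim b_n$ means $\liminf|a_n/b_n|>0$. A case distinction means: if the sequence $p=p(n)$ satisfies the asymptotic condition, then the corresponding relation holds. *)

theory Defs
  imports
    "HOL-Analysis.Finite_Function_Topology"
    "HOL-Probability.Probability"
    "HOL-Probability.Product_PMF"
begin

section \<open>Polytopes in coordinate spaces\<close>

text \<open>
  The dimension of the ambient space varies with \<open>n\<close>, so the space of real vectors indexed by
  a finite node set \<open>V\<close> is realised as the subspace of those finitely supported functions
  whose support lies in \<open>V\<close>. The standard basis vector at \<open>i\<close> is \<open>Poly_Mapping.single i 1\<close>.
\<close>

definition coord_space :: "'v set \<Rightarrow> ('v \<Rightarrow>\<^sub>0 real) set" where
  "coord_space V = {x. Poly_Mapping.keys x \<subseteq> V}"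

definition supporting_hyperplane ::
    "'v set \<Rightarrow> ('v \<Rightarrow>\<^sub>0 real) set \<Rightarrow> ('v \<Rightarrow>\<^sub>0 real) set \<Rightarrow> bool" where
  "supporting_hyperplane V P H \<longleftrightarrow>
     (\<exists>(a :: 'v \<Rightarrow> real) (b :: real).
        (\<exists>i\<in>V. a i \<noteq> 0) \<and>
        H = {x \<in> coord_space V. (\<Sum>i\<in>V. a i * Poly_Mapping.lookup x i) = b} \<and>
        (\<forall>x\<in>P. (\<Sum>i\<in>V. a i * Poly_Mapping.lookup x i) \<le> b) \<and>
        P \<inter> H \<noteq> {})"

text \<open>
  The condition \<open>F \<noteq> P\<close> is not automatic: a supporting hyperplane may contain a polytope that is
  not full-dimensional.
\<close>

definition polytope_face ::
    "'v set \<Rightarrow> ('v \<Rightarrow>\<^sub>0 real) set \<Rightarrow> ('v \<Rightarrow>\<^sub>0 real) set \<Rightarrow> bool" where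
  "polytope_face V P F \<longleftrightarrow> (\<exists>H. supporting_hyperplane V P H \<and> F = P \<inter> H) \<and> F \<noteq> P"

text \<open>
  The library's \<open>aff_dim\<close> is restricted to the class \<open>euclidean_space\<close>; this is the property
  by which it is defined there.
\<close>

definition has_aff_dim :: "'a::real_vector set \<Rightarrow> int \<Rightarrow> bool" where
  "has_aff_dim S d \<longleftrightarrow>
     (\<exists>B. finite B \<and> affine hull B = affine hull S \<and> \<not> affine_dependent B \<and>
          int (card B) = d + 1)"

definition polytope_edges ::
    "'v set \<Rightarrow> ('v \<Rightarrow>\<^sub>0 real) set \<Rightarrow> ('v \<Rightarrow>\<^sub>0 real) set set" where
  "polytope_edges V P = {F. polytope_face V P F \<and> has_aff_dim F 1}"


section \<open>Symmetric edge polytopes of random graphs\<close>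

definition all_arcs :: "'v set \<Rightarrow> 'v set set" where
  "all_arcs V = {e. e \<subseteq> V \<and> card e = 2}"

text \<open>
  An arc \<open>{i, j}\<close> is matched by both ordered pairs \<open>(i, j)\<close> and \<open>(j, i)\<close>, which produces both signs.
\<close>

definition symmetric_edge_polytope :: "'v set set \<Rightarrow> ('v \<Rightarrow>\<^sub>0 real) set" where
  "symmetric_edge_polytope E =
     convex hull {Poly_Mapping.single i 1 - Poly_Mapping.single j 1 | i j. {i, j} \<in> E}"

definition erdos_renyi :: "nat \<Rightarrow> real \<Rightarrow> nat set set pmf" where
  "erdos_renyi n q =
     map_pmf (\<lambda>\<omega>. {e \<in> all_arcs {1..n}. \<omega> e})
       (Pi_pmf (all_arcs {1..n}) False (\<lambda>_. bernoulli_pmf q))"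

definition num_polytope_edges :: "nat \<Rightarrow> nat set set \<Rightarrow> nat" where
  "num_polytope_edges n E = card (polytope_edges {1..n} (symmetric_edge_polytope E))"

definition expected_edges :: "nat \<Rightarrow> real \<Rightarrow> real" where
  "expected_edges n q =
     measure_pmf.expectation (erdos_renyi n q) (\<lambda>E. real (num_polytope_edges n E))"


section \<open>Asymptotic comparison of sequences\<close>

definition same_order :: "(nat \<Rightarrow> real) \<Rightarrow> (nat \<Rightarrow> real) \<Rightarrow> bool" where
  "same_order a b \<longleftrightarrow>
     0 < liminf (\<lambda>n. ereal \<bar>a n / b n\<bar>) \<and> limsup (\<lambda>n. ereal \<bar>a n / b n\<bar>) < \<infinity>"

definition much_less :: "(nat \<Rightarrow> real) \<Rightarrow> (nat \<Rightarrow> real) \<Rightarrow> bool" where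
  "much_less a b \<longleftrightarrow> limsup (\<lambda>n. ereal \<bar>a n / b n\<bar>) = 0"

definition much_greater :: "(nat \<Rightarrow> real) \<Rightarrow> (nat \<Rightarrow> real) \<Rightarrow> bool" where
  "much_greater a b \<longleftrightarrow> liminf (\<lambda>n. ereal \<bar>a n / b n\<bar>) = \<infinity>"

definition at_least_order :: "(nat \<Rightarrow> real) \<Rightarrow> (nat \<Rightarrow> real) \<Rightarrow> bool" where
  "at_least_order a b \<longleftrightarrow> liminf (\<lambda>n. ereal \<bar>a n / b n\<bar>) > 0"

end

theory Submission
  imports Defs
begin

text \<open>
  All generators \<open>e\<^sub>i - e\<^sub>j\<close> lie on a sphere, so an edge of \<open>P\<^sub>G\<close> contains exactly two of them and
  amounts to an unordered pair of generators on which some node weighting \<open>a\<close> has increment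
  \<open>a i - a j = 1\<close>, all other generators having increment less than \<open>1\<close>. Such a weighting exists for
  two disjoint oriented arcs \<open>(i, j)\<close>, \<open>(k, l)\<close> iff one of \<open>{i, l}\<close>, \<open>{k, j}\<close> is missing; always for two
  arcs leaving or entering a common node; and for a directed path \<open>(i, j)\<close>, \<open>(j, l)\<close> iff there is no
  arc \<open>{i, l}\<close> and no second path of length two from \<open>i\<close> to \<open>l\<close>. Each condition says that \<open>G\<close> contains
  a set of two arcs and includes none of several further pairwise disjoint sets of arcs, so its
  probability is a product; summing over ordered quadruples of nodes counts every edge twice.
\<close>

section \<open>Edges as exposed pairs of generators\<close>

definition arc_vec :: "'v \<Rightarrow> 'v \<Rightarrow> ('v \<Rightarrow>\<^sub>0 real)" where
  "arc_vec i j = Poly_Mapping.single i 1 - Poly_Mapping.single j 1"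

definition arc_vecs :: "'v set set \<Rightarrow> ('v \<Rightarrow>\<^sub>0 real) set" where
  "arc_vecs E = {arc_vec i j | i j. {i, j} \<in> E}"

definition functional :: "'v set \<Rightarrow> ('v \<Rightarrow> real) \<Rightarrow> ('v \<Rightarrow>\<^sub>0 real) \<Rightarrow> real" where
  "functional V a x = (\<Sum>i\<in>V. a i * Poly_Mapping.lookup x i)"

text \<open>Level 1 fixes the scale of the weighting: generators come in opposite pairs, so a
  hyperplane cutting out an edge has positive level and can be rescaled. The pair is ordered, hence
  each edge arises from two pairs.\<close>

definition exposed_pair ::
    "'v set \<Rightarrow> 'v set set \<Rightarrow> ('v \<Rightarrow>\<^sub>0 real) \<Rightarrow> ('v \<Rightarrow>\<^sub>0 real) \<Rightarrow> bool" where
  "exposed_pair V E u v \<longleftrightarrow> u \<in> arc_vecs E \<and> v \<in> arc_vecs E \<and> u \<noteq> v \<and>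
     (\<exists>a. functional V a u = 1 \<and> functional V a v = 1 \<and>
          (\<forall>w\<in>arc_vecs E - {u, v}. functional V a w < 1))"

section \<open>Generators and the linear functionals on them\<close>

lemma symmetric_edge_polytope_eq: "symmetric_edge_polytope E = convex hull (arc_vecs E)"
  by (simp add: symmetric_edge_polytope_def arc_vecs_def arc_vec_def)

lemma all_arcs_pair_iff: "{i, j} \<in> all_arcs V \<longleftrightarrow> i \<in> V \<and> j \<in> V \<and> i \<noteq> j"
  by (auto simp: all_arcs_def card_2_iff doubleton_eq_iff card_insert_if)

lemma finite_all_arcs [simp]: "finite V \<Longrightarrow> finite (all_arcs V)"
  by (simp add: all_arcs_def)

lemma lookup_scaleR: "Poly_Mapping.lookup (r *\<^sub>R x) i = r *\<^sub>R Poly_Mapping.lookup x i"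
  by (simp add: scaleR_poly_mapping_def)

lemma linear_functional: "linear (functional V a)"
  by (rule linearI)
     (simp_all add: functional_def lookup_add lookup_scaleR sum.distrib sum_distrib_left algebra_simps)

lemma functional_scale: "functional V (\<lambda>i. a i / c) x = functional V a x / c"
  by (simp add: functional_def sum_divide_distrib)

lemma functional_arc_vec:
  assumes "finite V" "i \<in> V" "j \<in> V"
  shows "functional V a (arc_vec i j) = a i - a j"
  using assms
  by (simp add: functional_def arc_vec_def lookup_minus lookup_single algebra_simps sum_subtractf
      when_def if_distrib[of "\<lambda>x. _ * x"] cong: if_cong)

lemma finite_arc_vecs:
  assumes "finite V" "E \<subseteq> all_arcs V"
  shows "finite (arc_vecs E)"
proof -
  have "arc_vecs E \<subseteq> (\<lambda>(i, j). arc_vec i j) ` (V \<times> V)"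
    using assms(2) all_arcs_pair_iff[of _ _ V] by (fastforce simp: arc_vecs_def)
  then show ?thesis using assms(1) finite_subset by blast
qed

lemma arc_vec_inject:
  assumes "i \<noteq> j" "k \<noteq> l"
  shows "arc_vec i j = arc_vec k l \<longleftrightarrow> i = k \<and> j = l"
proof
  assume eq: "arc_vec i j = arc_vec k l"
  have "Poly_Mapping.lookup (arc_vec i j) x = Poly_Mapping.lookup (arc_vec k l) x" for x
    by (simp add: eq)
  from this[of i] this[of j] show "i = k \<and> j = l"
    using assms by (auto simp: arc_vec_def lookup_minus lookup_single when_def split: if_splits)
qed simp

lemma arc_vec_uminus: "- arc_vec i j = arc_vec j i"
  by (simp add: arc_vec_def)

lemma uminus_arc_vecs: "u \<in> arc_vecs E \<Longrightarrow> - u \<in> arc_vecs E"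
  by (force simp: arc_vecs_def arc_vec_uminus insert_commute)

section \<open>Faces of the convex hull of the generators\<close>

text \<open>A convex combination reaches the maximal value \<open>b\<close> only if the nonnegative
  terms \<open>u s * (b - f s)\<close> all vanish, so it puts no mass on points below the
  hyperplane.\<close>

lemma convex_hull_Int_hyperplane:
  fixes S :: "'a::real_vector set" and f :: "'a \<Rightarrow> real"
  assumes "finite S" "linear f" "\<And>s. s \<in> S \<Longrightarrow> f s \<le> b"
  shows "convex hull S \<inter> {x. f x = b} = convex hull (S \<inter> {x. f x = b})"
proof
  have "f -` {b} = {x. f x = b}" by auto
  then have "convex {x. f x = b}"
    using convex_linear_vimage[OF assms(2), of "{b}"] by simp
  then show "convex hull (S \<inter> {x. f x = b}) \<subseteq> convex hull S \<inter> {x. f x = b}"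
    by (meson Int_lower1 Int_lower2 hull_minimal hull_mono le_inf_iff)
  show "convex hull S \<inter> {x. f x = b} \<subseteq> convex hull (S \<inter> {x. f x = b})"
  proof
    fix x assume x: "x \<in> convex hull S \<inter> {x. f x = b}"
    then obtain u where u: "\<And>s. s \<in> S \<Longrightarrow> 0 \<le> u s" "sum u S = 1" "(\<Sum>s\<in>S. u s *\<^sub>R s) = x"
      by (auto simp: convex_hull_finite[OF assms(1)])
    have "b = (\<Sum>s\<in>S. u s * f s)"
      using x u(3) by (auto simp: linear_sum[OF assms(2)] linear_scale[OF assms(2)])
    moreover have "(\<Sum>s\<in>S. u s * (b - f s)) = sum u S * b - (\<Sum>s\<in>S. u s * f s)"
      by (simp add: right_diff_distrib sum_subtractf sum_distrib_right)
    ultimately have "(\<Sum>s\<in>S. u s * (b - f s)) = 0"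
      using u(2) by simp
    then have "\<forall>s\<in>S. u s * (b - f s) = 0"
      using u(1) assms by (subst (asm) sum_nonneg_eq_0_iff) auto
    then have z: "\<forall>s\<in>S - (S \<inter> {x. f x = b}). u s = 0" by auto
    have "sum u (S \<inter> {x. f x = b}) = 1"
      using u(2) sum.mono_neutral_right[OF assms(1) _ z] by simp
    moreover have "(\<Sum>s\<in>S \<inter> {x. f x = b}. u s *\<^sub>R s) = x"
      using u(3) z sum.mono_neutral_right[OF assms(1), of "S \<inter> {x. f x = b}" "\<lambda>s. u s *\<^sub>R s"] by simp
    ultimately show "x \<in> convex hull (S \<inter> {x. f x = b})"
      using assms(1) u(1) by (auto simp: convex_hull_finite intro!: exI[of _ u])
  qed
qed

lemma functional_le_convex_hull:
  assumes "\<And>s. s \<in> S \<Longrightarrow> functional V a s \<le> b" "x \<in> convex hull S"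
  shows "functional V a x \<le> b"
proof -
  have "functional V a -` {..b} = {x. functional V a x \<le> b}" by auto
  then have "convex {x. functional V a x \<le> b}"
    using convex_linear_vimage[OF linear_functional, of "{..b}" V a] by simp
  then have "convex hull S \<subseteq> {x. functional V a x \<le> b}"
    using assms(1) by (intro hull_minimal) auto
  then show ?thesis using assms(2) by auto
qed

text \<open>With a vector as its own weighting, \<open>functional\<close> is the squared length; the
  generators have squared length 2.\<close>

lemma functional_arc_vec_self:
  assumes "finite V" "k \<in> V" "l \<in> V" "k \<noteq> l"
  shows "functional V (Poly_Mapping.lookup (arc_vec k l)) (arc_vec k l) = 2"
  using assms by (simp add: functional_arc_vec)
    (simp add: arc_vec_def lookup_minus lookup_single when_def)

text \<open>All generators lie on a common sphere, which a line meets in at most two points.\<close>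

lemma arc_vecs_affine_hull:
  assumes V: "finite V" "E \<subseteq> all_arcs V"
    and uvw: "u \<in> arc_vecs E" "v \<in> arc_vecs E" "w \<in> arc_vecs E" "w \<in> affine hull {u, v}"
  shows "w = u \<or> w = v"
proof -
  \<comment> \<open>\<open>N\<close> is the standard inner product on the coordinates in
    \<open>V\<close>.\<close>
  define N where "N x y = functional V (Poly_Mapping.lookup x) y" for x y
  have N_sym: "N x y = N y x" for x y
    by (simp add: N_def functional_def mult.commute)
  have N_add: "N x (y + z) = N x y + N x z" and N_scale: "N x (c *\<^sub>R y) = c * N x y" for x y z c
    using linear_functional[of V "Poly_Mapping.lookup x"]
    by (simp_all add: N_def linear_add linear_scale)
  have N_add': "N (y + z) x = N y x + N z x" and N_scale': "N (c *\<^sub>R y) x = c * N y x" for x y z c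
    by (simp_all add: N_sym[of _ x] N_add N_scale)
  have N2: "N x x = 2" if x: "x \<in> arc_vecs E" for x
  proof -
    obtain i j where "x = arc_vec i j" "{i, j} \<in> E" using x by (auto simp: arc_vecs_def)
    then show ?thesis
      using V all_arcs_pair_iff[of i j V] functional_arc_vec_self[of V i j] by (auto simp: N_def)
  qed
  obtain s t where st: "w = s *\<^sub>R u + t *\<^sub>R v" "s + t = 1"
    using uvw(4) by (auto simp: affine_hull_2)
  have "N w w = s * s * N u u + t * t * N v v + 2 * s * t * N u v"
    by (simp add: st N_add N_scale N_add' N_scale' N_sym[of v u] algebra_simps)
  then have "2 = s * s * 2 + t * t * 2 + 2 * s * t * N u v"
    using uvw by (simp add: N2)
  \<comment> \<open>Equal lengths leave only the endpoints \<open>t = 0\<close> and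
    \<open>s = 0\<close>, unless \<open>N u v = 2\<close>, which forces \<open>u = v\<close> because
    then \<open>u - v\<close> has length 0.\<close>
  moreover have s: "s = 1 - t" using st by simp
  ultimately have "t * (1 - t) * (N u v - 2) = 0"
    unfolding s by algebra
  then consider "t = 0" | "s = 0" | "N u v = 2" using s by auto
  then show ?thesis
  proof cases
    case 3
    have "N (u - v) (u - v) = 0"
      using 3 N2 uvw N_add[of "u - v" u "-1 *\<^sub>R v"] N_add'[of u "-1 *\<^sub>R v"]
      by (simp add: N_scale[of _ "-1", simplified] N_scale'[of "-1", simplified] N_sym[of v u])
    then have "(\<Sum>i\<in>V. Poly_Mapping.lookup (u - v) i * Poly_Mapping.lookup (u - v) i) = 0"
      by (simp add: N_def functional_def)
    then have z: "\<forall>i\<in>V. Poly_Mapping.lookup (u - v) i = 0"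
      using V(1) by (subst (asm) sum_nonneg_eq_0_iff) auto
    \<comment> \<open>\<open>N\<close> sees only coordinates in \<open>V\<close>; the generators
      vanish at all others.\<close>
    have "Poly_Mapping.lookup x i = 0" if x: "x \<in> arc_vecs E" "i \<notin> V" for x i
    proof -
      obtain k l where "x = arc_vec k l" "{k, l} \<in> E" using x by (auto simp: arc_vecs_def)
      then show ?thesis using x(2) V all_arcs_pair_iff[of k l V]
        by (auto simp: arc_vec_def lookup_minus lookup_single when_def)
    qed
    then have "u = v"
      using z uvw by (intro poly_mapping_eqI) (metis lookup_minus right_minus_eq)
    then show ?thesis using uvw(4) by (simp add: hull_same)
  qed (use st in auto)
qed

lemma arc_vecs_subset_coord_space:
  assumes "E \<subseteq> all_arcs V"
  shows "arc_vecs E \<subseteq> coord_space V"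
proof
  fix x assume "x \<in> arc_vecs E"
  then obtain i j where "x = arc_vec i j" "{i, j} \<in> E" by (auto simp: arc_vecs_def)
  then show "x \<in> coord_space V"
    using assms all_arcs_pair_iff[of i j V]
    by (auto simp: coord_space_def arc_vec_def in_keys_iff lookup_minus lookup_single when_def split: if_splits)
qed

lemma convex_coord_space: "convex (coord_space V)"
  unfolding convex_def coord_space_def
  by (auto simp: in_keys_iff lookup_add lookup_scaleR subset_iff)
    (metis add.right_neutral mult_zero_right)

lemma symmetric_edge_polytope_face:
  assumes "finite V" "E \<subseteq> all_arcs V" "\<And>u. u \<in> arc_vecs E \<Longrightarrow> functional V a u \<le> b"
  shows "symmetric_edge_polytope E \<inter> {x \<in> coord_space V. functional V a x = b}
    = convex hull (arc_vecs E \<inter> {x. functional V a x = b})"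
proof -
  have "symmetric_edge_polytope E \<subseteq> coord_space V"
    unfolding symmetric_edge_polytope_eq
    by (intro hull_minimal arc_vecs_subset_coord_space convex_coord_space assms)
  then have "symmetric_edge_polytope E \<inter> {x \<in> coord_space V. functional V a x = b}
    = convex hull (arc_vecs E) \<inter> {x. functional V a x = b}"
    unfolding symmetric_edge_polytope_eq by blast
  also have "\<dots> = convex hull (arc_vecs E \<inter> {x. functional V a x = b})"
    using assms finite_arc_vecs[of V E] by (intro convex_hull_Int_hyperplane linear_functional) auto
  finally show ?thesis .
qed

lemma has_aff_dim_segment:
  assumes "u \<noteq> v"
  shows "has_aff_dim (convex hull {u, v}) 1"
  unfolding has_aff_dim_def using assms by (intro exI[of _ "{u, v}"]) auto

text \<open>The affine hull is a line, so \<open>S\<close> has at least two points \<open>u\<close>,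
  \<open>v\<close>, which span that line; all of \<open>S\<close> lies on it and on the sphere of
  generators, leaving only \<open>u\<close> and \<open>v\<close>.\<close>

lemma segment_has_aff_dimE:
  assumes V: "finite V" "E \<subseteq> all_arcs V" and S: "S \<subseteq> arc_vecs E"
    and "has_aff_dim (convex hull S) 1"
  obtains u v where "u \<noteq> v" "S = {u, v}"
proof -
  obtain B where B: "finite B" "affine hull B = affine hull S" "card B = 2"
    using assms(4) by (auto simp: has_aff_dim_def)
  then obtain x y where xy: "B = {x, y}" "x \<noteq> y" by (auto simp: card_2_iff)
  have "S \<noteq> {}"
    using B xy by (metis affine_hull_eq_empty insert_not_empty)
  then obtain u where u: "u \<in> S" by auto
  have "S \<noteq> {u}"
  proof
    assume "S = {u}"
    then have "affine hull {x, y} = {u}" using B xy by simp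
    moreover have "{x, y} \<subseteq> affine hull {x, y}" by (rule hull_subset)
    ultimately show False using xy by auto
  qed
  then obtain v where v: "v \<in> S" "u \<noteq> v" using u by auto
  have "S \<subseteq> affine hull {u, v}"
  proof -
    have "u \<in> affine hull {x, y}" "v \<in> affine hull {x, y}"
      using u v B xy hull_inc[of _ S affine] by auto
    then obtain s t s' t' where *: "u = s *\<^sub>R x + t *\<^sub>R y" "s + t = 1"
      "v = s' *\<^sub>R x + t' *\<^sub>R y" "s' + t' = 1"
      by (auto simp: affine_hull_2)
    have s: "s = 1 - t" "s' = 1 - t'" using * by auto
    have tt: "t \<noteq> t'" using * s v(2) by auto
    have "w \<in> affine hull {u, v}" if w: "w \<in> S" for w
    proof -
      have "w \<in> affine hull {x, y}"
        using w B xy hull_inc[of _ S affine] by auto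
      then obtain c d where cd: "w = c *\<^sub>R x + d *\<^sub>R y" "c + d = 1" by (auto simp: affine_hull_2)
      \<comment> \<open>Position of \<open>w\<close> on the line through \<open>u\<close> and
        \<open>v\<close>, read off from the coefficients \<open>d\<close>, \<open>t\<close>,
        \<open>t'\<close> at \<open>y\<close>.\<close>
      define r where "r = (d - t) / (t' - t)"
      have "r * (t' - t) = d - t" using tt by (simp add: r_def)
      then have d: "(1 - r) * t + r * t' = d" by algebra
      have c: "(1 - r) * s + r * s' = c"
      proof -
        have "(1 - r) * s + r * s' = 1 - ((1 - r) * t + r * t')" unfolding s by algebra
        then show ?thesis using d cd by simp
      qed
      have "(1 - r) *\<^sub>R u + r *\<^sub>R v = ((1 - r) * s + r * s') *\<^sub>R x + ((1 - r) * t + r * t') *\<^sub>R y"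
        unfolding * by (simp add: scaleR_add_right scaleR_add_left)
      then have "(1 - r) *\<^sub>R u + r *\<^sub>R v = w" using c d cd by simp
      then show ?thesis unfolding affine_hull_2 by (intro CollectI exI[of _ "1 - r"] exI[of _ r]) auto
    qed
    then show ?thesis by auto
  qed
  then have "S = {u, v}"
    using u v S arc_vecs_affine_hull[OF V, of u v] by blast
  then show ?thesis using that v by blast
qed

section \<open>Correspondence between edges and exposed pairs\<close>

text \<open>The level \<open>b\<close> is positive: negating a generator shows
  \<open>b \<ge> 0\<close>, and at \<open>b = 0\<close> the functional would vanish on all
  generators, making the face the whole polytope. Dividing the weights by \<open>b\<close> gives
  level 1.\<close>

lemma polytope_edges_exposedE:
  assumes V: "finite V" "E \<subseteq> all_arcs V"
    and F: "F \<in> polytope_edges V (symmetric_edge_polytope E)"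
  obtains u v where "exposed_pair V E u v" "F = convex hull {u, v}"
proof -
  obtain a b where ab: "F = symmetric_edge_polytope E \<inter> {x \<in> coord_space V. functional V a x = b}"
    "\<forall>x\<in>symmetric_edge_polytope E. functional V a x \<le> b"
    and ne: "F \<noteq> symmetric_edge_polytope E" and dim: "has_aff_dim F 1"
    using F unfolding polytope_edges_def polytope_face_def supporting_hyperplane_def functional_def
    by blast
  have le: "functional V a u \<le> b" if "u \<in> arc_vecs E" for u
    using ab(2) that by (simp add: symmetric_edge_polytope_eq hull_inc)
  define S where "S = arc_vecs E \<inter> {x. functional V a x = b}"
  have FS: "F = convex hull S"
    using ab(1) symmetric_edge_polytope_face[OF V le] by (simp add: S_def)
  obtain u v where uv: "u \<noteq> v" "S = {u, v}"
    using segment_has_aff_dimE[OF V, of S] dim FS by (auto simp: S_def)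
  have uE: "u \<in> arc_vecs E" "v \<in> arc_vecs E" "functional V a u = b" "functional V a v = b"
    using uv(2) unfolding S_def by blast+
  have neg: "functional V a (- x) = - functional V a x" for x
    by (rule linear_neg[OF linear_functional])
  have "b \<ge> 0" using le[OF uminus_arc_vecs[OF uE(1)]] uE(3) neg[of u] by simp
  moreover have "b \<noteq> 0"
  proof
    assume "b = 0"
    then have "functional V a x = 0" if "x \<in> arc_vecs E" for x
      using le[OF that] le[OF uminus_arc_vecs[OF that]] neg[of x] by simp
    then have "S = arc_vecs E" by (auto simp: S_def \<open>b = 0\<close>)
    then show False using ne FS by (simp add: symmetric_edge_polytope_eq)
  qed
  ultimately have b: "b > 0" by simp
  have "exposed_pair V E u v"
    unfolding exposed_pair_def
  proof (intro conjI exI ballI uE uv(1))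
    show "functional V (\<lambda>i. a i / b) u = 1" "functional V (\<lambda>i. a i / b) v = 1"
      using b uE by (simp_all add: functional_scale)
    fix w assume w: "w \<in> arc_vecs E - {u, v}"
    then have "functional V a w < b" using le[of w] uv(2) unfolding S_def by force
    then show "functional V (\<lambda>i. a i / b) w < 1" using b by (simp add: functional_scale)
  qed
  then show ?thesis using that FS uv(2) by blast
qed

text \<open>The weighting of the pair supplies the supporting hyperplane at level 1. The face is
  proper because \<open>- u\<close> is at level -1.\<close>

lemma exposed_pair_edge:
  assumes V: "finite V" "E \<subseteq> all_arcs V" and ex: "exposed_pair V E u v"
  shows "convex hull {u, v} \<in> polytope_edges V (symmetric_edge_polytope E)"
proof -
  obtain a where a: "functional V a u = 1" "functional V a v = 1"
      "\<And>w. w \<in> arc_vecs E - {u, v} \<Longrightarrow> functional V a w < 1"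
    and uv: "u \<in> arc_vecs E" "v \<in> arc_vecs E" "u \<noteq> v"
    using ex unfolding exposed_pair_def by blast
  define H where "H = {x \<in> coord_space V. functional V a x = 1}"
  have le: "functional V a w \<le> 1" if "w \<in> arc_vecs E" for w
    using a that by (cases "w \<in> {u, v}") (auto intro: less_imp_le)
  have "arc_vecs E \<inter> {x. functional V a x = 1} = {u, v}"
    using a uv by fastforce
  then have FH: "symmetric_edge_polytope E \<inter> H = convex hull {u, v}"
    using symmetric_edge_polytope_face[OF V le] by (simp add: H_def)
  have "\<exists>i\<in>V. a i \<noteq> 0"
    using a(1) by (auto simp: functional_def intro: ccontr)
  moreover have "convex hull {u, v} \<noteq> {}" by simp
  ultimately have "supporting_hyperplane V (symmetric_edge_polytope E) H"
    unfolding supporting_hyperplane_def FH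
    using functional_le_convex_hull[OF le]
    by (intro exI[of _ a] exI[of _ 1]) (auto simp: H_def functional_def symmetric_edge_polytope_eq)
  moreover have "convex hull {u, v} \<noteq> symmetric_edge_polytope E"
  proof
    assume "convex hull {u, v} = symmetric_edge_polytope E"
    then have "- u \<in> H"
      using FH hull_inc[OF uminus_arc_vecs[OF uv(1)], of convex]
      by (auto simp: symmetric_edge_polytope_eq)
    then show False using a(1) linear_neg[OF linear_functional, of V a u] by (simp add: H_def)
  qed
  ultimately show ?thesis
    unfolding polytope_edges_def polytope_face_def
    using FH has_aff_dim_segment[OF uv(3)] by blast
qed

text \<open>Equal segments span the same line, and that line contains no generators beyond the two
  endpoints.\<close>

lemma convex_hull_pair_inject:
  assumes V: "finite V" "E \<subseteq> all_arcs V"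
    and "u \<in> arc_vecs E" "v \<in> arc_vecs E" "u' \<in> arc_vecs E" "v' \<in> arc_vecs E"
    and eq: "convex hull {u, v} = convex hull {u', v'}"
  shows "{u, v} = {u', v'}"
proof -
  have "affine hull {u, v} = affine hull {u', v'}"
    using arg_cong[OF eq, of "\<lambda>S. affine hull S"] by simp
  then have "u' \<in> affine hull {u, v}" "v' \<in> affine hull {u, v}"
    "u \<in> affine hull {u', v'}" "v \<in> affine hull {u', v'}"
    using hull_subset[of "{u, v}" affine] hull_subset[of "{u', v'}" affine] by auto
  then have "u' = u \<or> u' = v" "v' = u \<or> v' = v" "u = u' \<or> u = v'" "v = u' \<or> v = v'"
    using assms(3-6) by (blast dest: arc_vecs_affine_hull[OF V])+
  then show ?thesis by blast
qed

lemma card_exposed_pairs: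
  assumes V: "finite V" "E \<subseteq> all_arcs V"
  shows "card {(u, v). exposed_pair V E u v} = 2 * card (polytope_edges V (symmetric_edge_polytope E))"
proof -
  let ?Ed = "polytope_edges V (symmetric_edge_polytope E)"
  let ?X = "{(u, v). exposed_pair V E u v}"
  let ?h = "\<lambda>(u, v). convex hull {u, v}"
  have "?X \<subseteq> arc_vecs E \<times> arc_vecs E" by (auto simp: exposed_pair_def)
  then have fin: "finite ?X" using finite_arc_vecs[OF V] finite_subset by blast
  have img: "?h ` ?X = ?Ed"
  proof (intro equalityI subsetI)
    fix F assume "F \<in> ?Ed"
    then show "F \<in> ?h ` ?X"
      by (rule polytope_edges_exposedE[OF V]) blast
  qed (use exposed_pair_edge[OF V] in auto)
  have fib: "card {x \<in> ?X. ?h x = F} = 2" if F: "F \<in> ?Ed" for F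
  proof -
    obtain u v where uv: "exposed_pair V E u v" "F = convex hull {u, v}"
      using polytope_edges_exposedE[OF V F] by blast
    have vu: "exposed_pair V E v u"
      using uv(1) unfolding exposed_pair_def by (metis insert_commute)
    have "{x \<in> ?X. ?h x = F} = {(u, v), (v, u)}"
    proof (intro equalityI subsetI)
      fix x assume "x \<in> {x \<in> ?X. ?h x = F}"
      then obtain u' v' where x: "x = (u', v')" "exposed_pair V E u' v'"
        "convex hull {u', v'} = convex hull {u, v}" using uv by auto
      have "{u', v'} = {u, v}"
        using convex_hull_pair_inject[OF V _ _ _ _ x(3)] x(2) uv(1) unfolding exposed_pair_def by blast
      then show "x \<in> {(u, v), (v, u)}" using x(1) by (auto simp: doubleton_eq_iff)
    qed (use uv vu in \<open>auto simp: insert_commute\<close>)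
    then show ?thesis using uv(1) by (simp add: exposed_pair_def)
  qed
  have "card ?X = (\<Sum>F\<in>?h ` ?X. card {x \<in> ?X. ?h x = F})"
    using sum.image_gen[OF fin, of "\<lambda>_. 1::nat" ?h] by simp
  also have "\<dots> = (\<Sum>F\<in>?Ed. 2)"
    unfolding img by (rule sum.cong) (use fib in auto)
  finally show ?thesis by simp
qed

section \<open>Existence of exposing weights\<close>

text \<open>Moves the question from vectors to node weights: generators correspond faithfully to
  ordered pairs of adjacent nodes, and \<open>functional\<close> becomes the increment of the
  weighting.\<close>

lemma exposed_pair_arc_vec_iff:
  assumes V: "finite V" "E \<subseteq> all_arcs V" and ne: "i \<noteq> j" "k \<noteq> l"
  shows "exposed_pair V E (arc_vec i j) (arc_vec k l) \<longleftrightarrow>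
    {i, j} \<in> E \<and> {k, l} \<in> E \<and> (i, j) \<noteq> (k, l) \<and>
    (\<exists>a. a i - a j = 1 \<and> a k - a l = (1::real) \<and>
      (\<forall>x y. {x, y} \<in> E \<longrightarrow> (x, y) \<notin> {(i, j), (k, l)} \<longrightarrow> a x - a y < 1))"
proof -
  have EV: "x \<in> V \<and> y \<in> V \<and> x \<noteq> y" if "{x, y} \<in> E" for x y
    using that V(2) all_arcs_pair_iff[of x y V] by blast
  have mem: "arc_vec x y \<in> arc_vecs E \<longleftrightarrow> {x, y} \<in> E" if "x \<noteq> y" for x y
    using that arc_vec_inject[of x y] EV unfolding arc_vecs_def by blast
  have eq: "(\<forall>w\<in>arc_vecs E - {arc_vec i j, arc_vec k l}. functional V a w < 1) \<longleftrightarrow>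
    (\<forall>x y. {x, y} \<in> E \<longrightarrow> (x, y) \<notin> {(i, j), (k, l)} \<longrightarrow> a x - a y < 1)" (is "?L \<longleftrightarrow> ?R") for a
  proof
    assume L: ?L
    show ?R
    proof (intro allI impI)
      fix x y assume xy: "{x, y} \<in> E" "(x, y) \<notin> {(i, j), (k, l)}"
      then have "arc_vec x y \<in> arc_vecs E - {arc_vec i j, arc_vec k l}"
        using mem[of x y] EV[OF xy(1)] ne by (auto simp: arc_vec_inject)
      then show "a x - a y < 1"
        using L EV[OF xy(1)] V(1) by (metis functional_arc_vec)
    qed
  next
    assume R: ?R
    show ?L
    proof
      fix w assume w: "w \<in> arc_vecs E - {arc_vec i j, arc_vec k l}"
      then obtain x y where xy: "w = arc_vec x y" "{x, y} \<in> E" by (auto simp: arc_vecs_def)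
      then show "functional V a w < 1"
        using R w EV[OF xy(2)] V(1) by (auto simp: functional_arc_vec)
    qed
  qed
  show ?thesis
  proof (cases "{i, j} \<in> E \<and> {k, l} \<in> E")
    case True
    then show ?thesis
      using EV[of i j] EV[of k l] V(1) ne
      by (auto simp: exposed_pair_def mem eq functional_arc_vec arc_vec_inject)
  next
    case False
    then show ?thesis using mem ne by (auto simp: exposed_pair_def)
  qed
qed

lemma exposed_pair_commute: "exposed_pair V E u v \<longleftrightarrow> exposed_pair V E v u"
  unfolding exposed_pair_def by (metis insert_commute)

text \<open>The weighting changes sign along with the generators. This reduces a common head to a
  common tail.\<close>

lemma exposed_pair_uminus: "exposed_pair V E (- u) (- v) \<longleftrightarrow> exposed_pair V E u v"
proof -
  have neg: "functional V (\<lambda>i. - a i) x = functional V a (- x)" for a x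
    by (simp add: functional_def)
  have imp: "exposed_pair V E (- u) (- v)" if ex: "exposed_pair V E u v" for u v
  proof -
    obtain a where a: "functional V a u = 1" "functional V a v = 1"
        "\<And>w. w \<in> arc_vecs E - {u, v} \<Longrightarrow> functional V a w < 1"
      and uv: "u \<in> arc_vecs E" "v \<in> arc_vecs E" "u \<noteq> v"
      using ex unfolding exposed_pair_def by blast
    have "- w \<in> arc_vecs E - {u, v}" if "w \<in> arc_vecs E - {- u, - v}" for w
      using that uminus_arc_vecs[of w E] by auto
    then show ?thesis
      unfolding exposed_pair_def using a uv uminus_arc_vecs
      by (intro conjI exI[of _ "\<lambda>i. - a i"]) (auto simp: neg)
  qed
  show ?thesis using imp[of u v] imp[of "- u" "- v"] by auto
qed

text \<open>The increments along \<open>(i, l)\<close> and \<open>(k, j)\<close> have the same sum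
  as those along the two given arcs, namely 2, so they cannot both be below 1. If
  \<open>{i, l}\<close> is missing, an explicit weighting works; exchanging the two arcs covers a
  missing \<open>{k, j}\<close>.\<close>

lemma exposed_disjoint_arcs_iff:
  assumes V: "finite V" "E \<subseteq> all_arcs V" and d: "distinct [i, j, k, l]"
  shows "exposed_pair V E (arc_vec i j) (arc_vec k l) \<longleftrightarrow>
    {i, j} \<in> E \<and> {k, l} \<in> E \<and> \<not> ({i, l} \<in> E \<and> {k, j} \<in> E)"
proof -
  have weights: "\<exists>a. a i - a j = 1 \<and> a k - a l = (1::real) \<and>
      (\<forall>x y. {x, y} \<in> E \<longrightarrow> (x, y) \<notin> {(i, j), (k, l)} \<longrightarrow> a x - a y < 1)"
    if "{i, l} \<notin> E" "distinct [i, j, k, l]" for i j k l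
  proof -
    \<comment> \<open>Take 1/2 at both tails and -1/2 at both heads, then raise \<open>i\<close>,
      \<open>j\<close> and lower \<open>k\<close>, \<open>l\<close> by 1/8. The increments along the
      two arcs stay 1, the one from \<open>k\<close> to \<open>j\<close> drops to 3/4, and only the
      one from \<open>i\<close> to \<open>l\<close>, not an arc here, exceeds 1.\<close>
    define w :: "_ \<Rightarrow> real" where "w x = (if x = i then 5/8 else if x = j then -3/8
      else if x = k then 3/8 else if x = l then -5/8 else 0)" for x
    have w: "w i = 5/8" "w j = -3/8" "w k = 3/8" "w l = -5/8"
      "\<And>x. x \<noteq> i \<Longrightarrow> w x \<le> 3/8" "\<And>x. x \<notin> {i, k} \<Longrightarrow> w x \<le> 0"
      "\<And>x. x \<noteq> l \<Longrightarrow> -3/8 \<le> w x" "\<And>x. x \<notin> {j, l} \<Longrightarrow> 0 \<le> w x"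
      using that(2) by (auto simp: w_def)
    have "w x - w y < 1" if xy: "{x, y} \<in> E" "(x, y) \<notin> {(i, j), (k, l)}" for x y
    proof (cases "x = i")
      case True
      then have "y \<notin> {j, l}" using xy \<open>{i, l} \<notin> E\<close> by auto
      then show ?thesis using w(1) w(8)[of y] True by simp
    next
      case x: False
      show ?thesis
      proof (cases "y = l")
        case True
        then have "x \<notin> {i, k}" using xy x by auto
        then show ?thesis using w(4) w(6)[of x] True by simp
      qed (use w(5)[OF x] w(7)[of y] in simp)
    qed
    then show ?thesis using w(1-4) by (intro exI[of _ w]) simp
  qed
  have "\<exists>a. a i - a j = 1 \<and> a k - a l = (1::real) \<and>
      (\<forall>x y. {x, y} \<in> E \<longrightarrow> (x, y) \<notin> {(i, j), (k, l)} \<longrightarrow> a x - a y < 1)"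
    if "\<not> ({i, l} \<in> E \<and> {k, j} \<in> E)"
  proof (cases "{i, l} \<in> E")
    case False
    then show ?thesis using weights[of i l j k] d by blast
  next
    case True
    then have "{k, j} \<notin> E" using that by simp
    moreover have "distinct [k, l, i, j]" using d by auto
    ultimately show ?thesis using weights[of k j l i] by (metis insert_commute)
  qed
  moreover have "\<not> ({i, l} \<in> E \<and> {k, j} \<in> E)"
    if a: "a i - a j = 1" "a k - a l = (1::real)"
      "\<And>x y. {x, y} \<in> E \<Longrightarrow> (x, y) \<notin> {(i, j), (k, l)} \<Longrightarrow> a x - a y < 1" for a
  proof
    assume "{i, l} \<in> E \<and> {k, j} \<in> E"
    then have "a i - a l < 1" "a k - a j < 1"
      using a(3)[of i l] a(3)[of k j] d by auto
    then show False using a(1,2) by linarith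
  qed
  ultimately show ?thesis
    using d by (subst exposed_pair_arc_vec_iff[OF V]) (auto simp del: insert_iff)
qed

lemma exposed_common_tail_iff:
  assumes V: "finite V" "E \<subseteq> all_arcs V" and d: "distinct [i, j, l]"
  shows "exposed_pair V E (arc_vec i j) (arc_vec i l) \<longleftrightarrow> {i, j} \<in> E \<and> {i, l} \<in> E"
proof -
  have "\<exists>a. a i - a j = 1 \<and> a i - a l = (1::real) \<and>
      (\<forall>x y. {x, y} \<in> E \<longrightarrow> (x, y) \<notin> {(i, j), (i, l)} \<longrightarrow> a x - a y < 1)"
    \<comment> \<open>All other increments are at most 1/2.\<close>
    using d by (intro exI[of _ "\<lambda>x. if x = i then 1/2 else if x = j \<or> x = l then -1/2 else 0"]) auto
  then show ?thesis using d by (subst exposed_pair_arc_vec_iff[OF V]) auto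
qed

text \<open>The increment from \<open>i\<close> to \<open>l\<close> is 2, too large for a single
  further arc and for two further arcs in a row. Conversely, each outer node is adjacent to at most
  one of \<open>i\<close> and \<open>l\<close>, so its weight can be moved towards that end.\<close>

lemma exposed_path_iff:
  assumes V: "finite V" "E \<subseteq> all_arcs V" and d: "distinct [i, j, l]"
  shows "exposed_pair V E (arc_vec i j) (arc_vec j l) \<longleftrightarrow>
    {i, j} \<in> E \<and> {j, l} \<in> E \<and> {i, l} \<notin> E \<and> (\<forall>m\<in>V - {i, j, l}. \<not> ({i, m} \<in> E \<and> {m, l} \<in> E))"
proof -
  \<comment> \<open>\<open>1/3\<close> rather than \<open>1/2\<close>: two outer nodes weighted \<open>1/3\<close> and \<open>- 1/3\<close> may be adjacent.\<close>
  let ?w = "\<lambda>x. if x = i then 1 else if x = j then 0 else if x = l then -1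
    else if {i, x} \<in> E then 1/3 else if {x, l} \<in> E then -1/3 else (0::real)"
  have "\<exists>a. a i - a j = 1 \<and> a j - a l = (1::real) \<and>
      (\<forall>x y. {x, y} \<in> E \<longrightarrow> (x, y) \<notin> {(i, j), (j, l)} \<longrightarrow> a x - a y < 1)"
    if il: "{i, l} \<notin> E" and m: "\<forall>m\<in>V - {i, j, l}. \<not> ({i, m} \<in> E \<and> {m, l} \<in> E)"
  proof (intro exI[of _ ?w] conjI allI impI)
    fix x y assume xy: "{x, y} \<in> E" "(x, y) \<notin> {(i, j), (j, l)}"
    then have V': "x \<in> V" "y \<in> V" "x \<noteq> y" using V(2) all_arcs_pair_iff[of x y V] by blast+
    show "?w x - ?w y < 1"
    proof (cases "x = i")
      case True
      then have "y \<noteq> j" "y \<noteq> l" "{i, y} \<in> E" using xy il by auto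
      then show ?thesis using True V' by auto
    next
      case x: False
      show ?thesis
      proof (cases "y = l")
        case True
        then have "x \<noteq> j" "x \<noteq> i" "{x, l} \<in> E" using xy il by auto
        moreover from this have "{i, x} \<notin> E" using m V' True by auto
        ultimately show ?thesis using True V' d by auto
      qed (use x d in auto)
    qed
  qed (use d in auto)
  moreover have "{i, l} \<notin> E \<and> (\<forall>m\<in>V - {i, j, l}. \<not> ({i, m} \<in> E \<and> {m, l} \<in> E))"
    if a: "a i - a j = 1" "a j - a l = (1::real)"
      "\<And>x y. {x, y} \<in> E \<Longrightarrow> (x, y) \<notin> {(i, j), (j, l)} \<Longrightarrow> a x - a y < 1" for a
  proof (intro conjI ballI notI)
    assume "{i, l} \<in> E"
    then show False using a(3)[of i l] a(1,2) d by auto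
  next
    fix m assume "m \<in> V - {i, j, l}" "{i, m} \<in> E \<and> {m, l} \<in> E"
    then have "a i - a m < 1" "a m - a l < 1" using a(3)[of i m] a(3)[of m l] by auto
    then show False using a(1,2) by linarith
  qed
  ultimately show ?thesis
    using d by (subst exposed_pair_arc_vec_iff[OF V]) (auto simp del: insert_iff)
qed

lemma not_exposed_opposite: "\<not> exposed_pair V E u (- u)"
proof
  assume "exposed_pair V E u (- u)"
  then obtain a where "functional V a u = 1" "functional V a (- u) = 1"
    unfolding exposed_pair_def by blast
  then show False using linear_neg[OF linear_functional, of V a u] by simp
qed

section \<open>Expected number of edges\<close>

lemma finite_set_erdos_renyi: "finite (set_pmf (erdos_renyi n q))"
  by (rule finite_subset[of _ "Pow (all_arcs {1..n})"]) (auto simp: erdos_renyi_def)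

lemma set_erdos_renyi: "E \<in> set_pmf (erdos_renyi n q) \<Longrightarrow> E \<subseteq> all_arcs {1..n}"
  by (auto simp: erdos_renyi_def)

text \<open>The event constrains each arc separately, so it is a product set under
  \<open>Pi_pmf\<close>.\<close>

lemma prob_erdos_renyi_superset:
  assumes "0 \<le> q" "q \<le> 1" "A \<subseteq> all_arcs {1..n}"
  shows "measure_pmf.prob (erdos_renyi n q) {E. A \<subseteq> E} = q ^ card A"
proof -
  let ?V = "all_arcs {1..n}"
  have "measure_pmf.prob (erdos_renyi n q) {E. A \<subseteq> E} =
    measure_pmf.prob (Pi_pmf ?V False (\<lambda>_. bernoulli_pmf q)) (Pi ?V (\<lambda>e. if e \<in> A then {True} else UNIV))"
    unfolding erdos_renyi_def measure_map_pmf
    using assms(3) by (intro arg_cong[of _ _ "measure_pmf.prob _"]) (auto simp: Pi_def)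
  also have "\<dots> = (\<Prod>e\<in>?V. if e \<in> A then q else 1)"
    using assms by (subst measure_Pi_pmf_Pi) (auto simp: measure_pmf_single intro!: prod.cong)
  also have "\<dots> = q ^ card A"
    using assms(3) by (simp add: prod.If_cases Int_absorb1)
  finally show ?thesis .
qed

text \<open>
  Induction on \<open>T\<close> for all \<open>A\<close>: avoiding one more set \<open>B s\<close> subtracts the same event for \<open>A \<union> B s\<close>.
\<close>

lemma prob_erdos_renyi_superset_avoid:
  assumes q: "0 \<le> q" "q \<le> 1" and "finite T"
    and "A \<subseteq> all_arcs {1..n}" "\<And>t. t \<in> T \<Longrightarrow> B t \<subseteq> all_arcs {1..n}"
    and "\<And>t. t \<in> T \<Longrightarrow> A \<inter> B t = {}" "disjoint_family_on B T"
  shows "measure_pmf.prob (erdos_renyi n q) {E. A \<subseteq> E \<and> (\<forall>t\<in>T. \<not> B t \<subseteq> E)} =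
    q ^ card A * (\<Prod>t\<in>T. 1 - q ^ card (B t))"
  using assms(3-)
proof (induction T arbitrary: A)
  case empty
  then show ?case using prob_erdos_renyi_superset[OF q] by simp
next
  case (insert s T)
  let ?ev = "\<lambda>A. {E. A \<subseteq> E \<and> (\<forall>t\<in>T. \<not> B t \<subseteq> E)}"
  let ?P = "measure_pmf.prob (erdos_renyi n q)"
  have dj: "disjoint_family_on B T" "\<And>t. t \<in> T \<Longrightarrow> B s \<inter> B t = {}"
    using insert.prems(4) insert.hyps(2) by (auto simp: disjoint_family_on_def)
  have "{E. A \<subseteq> E \<and> (\<forall>t\<in>insert s T. \<not> B t \<subseteq> E)} = ?ev A - ?ev (A \<union> B s)" by auto
  then have "?P {E. A \<subseteq> E \<and> (\<forall>t\<in>insert s T. \<not> B t \<subseteq> E)} = ?P (?ev A) - ?P (?ev (A \<union> B s))"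
    by (simp add: measure_pmf.finite_measure_Diff Collect_mono)
  also have "?P (?ev A) = q ^ card A * (\<Prod>t\<in>T. 1 - q ^ card (B t))"
    using insert.prems dj by (intro insert.IH) auto
  also have "?P (?ev (A \<union> B s)) = q ^ card (A \<union> B s) * (\<Prod>t\<in>T. 1 - q ^ card (B t))"
    using insert.prems dj by (intro insert.IH) (simp_all add: Int_Un_distrib2)
  also have "card (A \<union> B s) = card A + card (B s)"
  proof (rule card_Un_disjoint)
    show "finite A" "finite (B s)"
      using finite_subset[OF insert.prems(1)] finite_subset[OF insert.prems(2)[of s]] by simp_all
  qed (use insert.prems in auto)
  finally show ?case
    using insert.hyps by (simp add: power_add algebra_simps)
qed

text \<open>Allows events to be rewritten by the exposure criteria, which presuppose
  \<open>E \<subseteq> all_arcs {1..n}\<close>.\<close>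

lemma prob_cong_set_pmf:
  assumes "\<And>x. x \<in> set_pmf M \<Longrightarrow> P x \<longleftrightarrow> Q x"
  shows "measure_pmf.prob M {x. P x} = measure_pmf.prob M {x. Q x}"
  by (rule measure_pmf.finite_measure_eq_AE) (use assms in \<open>auto simp: AE_measure_pmf_iff\<close>)

section \<open>Exposure probability of each configuration of two arcs\<close>

context
  fixes n :: nat and q :: real
  assumes q: "0 \<le> q" "q \<le> 1"
begin

abbreviation prob_exposed :: "nat \<Rightarrow> nat \<Rightarrow> nat \<Rightarrow> nat \<Rightarrow> real" where
  "prob_exposed i j k l \<equiv> measure_pmf.prob (erdos_renyi n q)
     {E. exposed_pair {1..n} E (arc_vec i j) (arc_vec k l)}"

lemma prob_exposed_disjoint:
  assumes "{i, j, k, l} \<subseteq> {1..n}" "distinct [i, j, k, l]"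
  shows "prob_exposed i j k l = q\<^sup>2 * (1 - q\<^sup>2)"
proof -
  \<comment> \<open>The one-point index set casts the single forbidden pair of arcs in the form of
    \<open>prob_erdos_renyi_superset_avoid\<close>.\<close>
  have "prob_exposed i j k l = measure_pmf.prob (erdos_renyi n q)
     {E. {{i, j}, {k, l}} \<subseteq> E \<and> (\<forall>t\<in>{()}. \<not> {{i, l}, {k, j}} \<subseteq> E)}"
    using assms(2)
    by (intro prob_cong_set_pmf, subst exposed_disjoint_arcs_iff[OF _ set_erdos_renyi]) auto
  also have "\<dots> = q ^ card {{i, j}, {k, l}} * (\<Prod>t\<in>{()}. 1 - q ^ card {{i, l}, {k, j}})"
    using assms q
    by (intro prob_erdos_renyi_superset_avoid) (auto simp: all_arcs_pair_iff doubleton_eq_iff disjoint_family_on_def)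
  also have "\<dots> = q\<^sup>2 * (1 - q\<^sup>2)"
    using assms by (simp add: doubleton_eq_iff card_insert_if power2_eq_square)
  finally show ?thesis .
qed

lemma prob_exposed_common_tail:
  assumes "{i, j, l} \<subseteq> {1..n}" "distinct [i, j, l]"
  shows "prob_exposed i j i l = q\<^sup>2"
proof -
  have "prob_exposed i j i l = measure_pmf.prob (erdos_renyi n q) {E. {{i, j}, {i, l}} \<subseteq> E}"
    using assms(2)
    by (intro prob_cong_set_pmf, subst exposed_common_tail_iff[OF _ set_erdos_renyi]) auto
  also have "\<dots> = q ^ card {{i, j}, {i, l}}"
    using assms q by (intro prob_erdos_renyi_superset) (auto simp: all_arcs_pair_iff)
  also have "\<dots> = q\<^sup>2"
    using assms by (simp add: doubleton_eq_iff card_insert_if power2_eq_square)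
  finally show ?thesis .
qed

text \<open>Negating both generators reverses the arcs, turning a common head into a common
  tail.\<close>

lemma prob_exposed_common_head:
  assumes "{i, j, l} \<subseteq> {1..n}" "distinct [i, j, l]"
  shows "prob_exposed j i l i = q\<^sup>2"
  using prob_exposed_common_tail[OF assms] exposed_pair_uminus[of _ _ "arc_vec i j" "arc_vec i l"]
  by (simp add: arc_vec_uminus)

text \<open>The factor \<open>1 - q\<close> comes from the forbidden arc \<open>{i, l}\<close>; each
  of the \<open>n - 3\<close> remaining nodes contributes a forbidden pair of arcs to both
  ends.\<close>

lemma prob_exposed_path:
  assumes "{i, j, l} \<subseteq> {1..n}" "distinct [i, j, l]"
  shows "prob_exposed i j j l = q\<^sup>2 * ((1 - q) * (1 - q\<^sup>2) ^ (n - 3))"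
proof -
  \<comment> \<open>The index \<open>j\<close>, the middle of the path itself, is free to label the
    forbidden arc \<open>{i, l}\<close>; the other indices are the possible middle nodes of a second
    path.\<close>
  define B where "B t = (if t = j then {{i, l}} else {{i, t}, {t, l}})" for t
  let ?T = "{1..n} - {i, l}"
  have T: "?T = insert j ({1..n} - {i, j, l})" using assms by auto
  have "prob_exposed i j j l = measure_pmf.prob (erdos_renyi n q)
     {E. {{i, j}, {j, l}} \<subseteq> E \<and> (\<forall>t\<in>?T. \<not> B t \<subseteq> E)}"
  proof (rule prob_cong_set_pmf)
    fix E assume "E \<in> set_pmf (erdos_renyi n q)"
    then have "exposed_pair {1..n} E (arc_vec i j) (arc_vec j l) \<longleftrightarrow> {i, j} \<in> E \<and> {j, l} \<in> E \<and>
      {i, l} \<notin> E \<and> (\<forall>m\<in>{1..n} - {i, j, l}. \<not> ({i, m} \<in> E \<and> {m, l} \<in> E))"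
      using assms(2) by (intro exposed_path_iff set_erdos_renyi) auto
    also have "\<dots> \<longleftrightarrow> {{i, j}, {j, l}} \<subseteq> E \<and> (\<forall>t\<in>?T. \<not> B t \<subseteq> E)"
      unfolding T ball_simps by (auto simp: B_def)
    finally show "exposed_pair {1..n} E (arc_vec i j) (arc_vec j l) \<longleftrightarrow>
      {{i, j}, {j, l}} \<subseteq> E \<and> (\<forall>t\<in>?T. \<not> B t \<subseteq> E)" .
  qed
  also have "\<dots> = q ^ card {{i, j}, {j, l}} * (\<Prod>t\<in>?T. 1 - q ^ card (B t))"
    using assms q
    by (intro prob_erdos_renyi_superset_avoid)
       (auto simp: all_arcs_pair_iff doubleton_eq_iff disjoint_family_on_def B_def split: if_splits)
  also have "(\<Prod>t\<in>?T. 1 - q ^ card (B t)) = (1 - q) * (\<Prod>t\<in>{1..n} - {i, j, l}. 1 - q ^ card (B t))"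
    unfolding T by (subst prod.insert) (auto simp: B_def)
  also have "(\<Prod>t\<in>{1..n} - {i, j, l}. 1 - q ^ card (B t)) = (\<Prod>t\<in>{1..n} - {i, j, l}. 1 - q\<^sup>2)"
    using assms by (intro prod.cong) (auto simp: B_def doubleton_eq_iff card_insert_if power2_eq_square)
  also have "\<dots> = (1 - q\<^sup>2) ^ card ({1..n} - {i, j, l})" by simp
  also have "card ({1..n} - {i, j, l}) = n - 3"
    using assms by (subst card_Diff_subset) auto
  also have "q ^ card {{i, j}, {j, l}} = q\<^sup>2"
    using assms by (simp add: doubleton_eq_iff card_insert_if power2_eq_square)
  finally show ?thesis .
qed

end

section \<open>Double counting and linearity of expectation\<close>

text \<open>Quadruples of nodes encode ordered pairs of generators, since \<open>arc_vec\<close> is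
  injective off the diagonal; \<open>card_exposed_pairs\<close> gives the factor 2.\<close>

lemma twice_num_polytope_edges:
  assumes E: "E \<subseteq> all_arcs {1..n}"
  shows "2 * real (num_polytope_edges n E) =
    (\<Sum>(i, j, k, l)\<in>{(i, j, k, l). {i, j, k, l} \<subseteq> {1..n} \<and> i \<noteq> j \<and> k \<noteq> l}.
       of_bool (exposed_pair {1..n} E (arc_vec i j) (arc_vec k l)))"
    (is "_ = sum _ ?Q")
proof -
  let ?P = "\<lambda>(i, j, k, l). exposed_pair {1..n} E (arc_vec i j) (arc_vec k l)"
  let ?h = "\<lambda>(i, j, k, l). (arc_vec i j, arc_vec k l)"
  have "?Q \<subseteq> {1..n} \<times> {1..n} \<times> {1..n} \<times> {1..n}" by auto
  then have fin: "finite ?Q" by (rule finite_subset) simp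
  have "{(u, v). exposed_pair {1..n} E u v} = ?h ` (?Q \<inter> {x. ?P x})"
  proof (intro equalityI subsetI)
    fix x assume "x \<in> {(u, v). exposed_pair {1..n} E u v}"
    then obtain u v where x: "x = (u, v)" "exposed_pair {1..n} E u v" by auto
    then obtain i j k l where "u = arc_vec i j" "{i, j} \<in> E" "v = arc_vec k l" "{k, l} \<in> E"
      unfolding exposed_pair_def arc_vecs_def by blast
    then have "(i, j, k, l) \<in> ?Q \<inter> {x. ?P x}" "x = ?h (i, j, k, l)"
      using x E all_arcs_pair_iff[of i j "{1..n}"] all_arcs_pair_iff[of k l "{1..n}"] by auto
    then show "x \<in> ?h ` (?Q \<inter> {x. ?P x})" by blast
  qed auto
  moreover have "inj_on ?h (?Q \<inter> {x. ?P x})"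
    by (rule inj_onI) (auto simp: arc_vec_inject)
  ultimately have "card {(u, v). exposed_pair {1..n} E u v} = card (?Q \<inter> {x. ?P x})"
    by (simp add: card_image)
  then have "2 * real (num_polytope_edges n E) = real (card (?Q \<inter> {x. ?P x}))"
    using card_exposed_pairs[OF _ E] by (simp add: num_polytope_edges_def)
  also have "\<dots> = (\<Sum>x\<in>?Q. of_bool (?P x))"
    using fin by (simp add: sum_of_bool_eq)
  finally show ?thesis by (simp add: case_prod_unfold)
qed

lemma twice_expected_edges:
  "2 * expected_edges n q =
    (\<Sum>(i, j, k, l)\<in>{(i, j, k, l). {i, j, k, l} \<subseteq> {1..n} \<and> i \<noteq> j \<and> k \<noteq> l}. prob_exposed n q i j k l)"
    (is "_ = sum _ ?Q")
proof -
  let ?G = "erdos_renyi n q"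
  let ?P = "\<lambda>(i, j, k, l) E. exposed_pair {1..n} E (arc_vec i j) (arc_vec k l)"
  note int = integrable_measure_pmf_finite[OF finite_set_erdos_renyi[of n q]]
  have "2 * expected_edges n q = measure_pmf.expectation ?G (\<lambda>E. 2 * real (num_polytope_edges n E))"
    by (simp add: expected_edges_def)
  also have "\<dots> = measure_pmf.expectation ?G (\<lambda>E. \<Sum>x\<in>?Q. of_bool (?P x E))"
    using twice_num_polytope_edges[OF set_erdos_renyi]
    by (intro integral_cong_AE) (simp_all add: AE_measure_pmf_iff case_prod_unfold)
  also have "\<dots> = (\<Sum>x\<in>?Q. measure_pmf.expectation ?G (\<lambda>E. of_bool (?P x E)))"
    by (rule Bochner_Integration.integral_sum) (rule int)
  also have "\<dots> = (\<Sum>x\<in>?Q. measure_pmf.prob ?G {E. ?P x E})"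
  proof (rule sum.cong)
    fix x assume "x \<in> ?Q"
    have "(\<lambda>E. of_bool (?P x E)) = (indicator {E. ?P x E} :: _ \<Rightarrow> real)"
      by (auto simp: indicator_def)
    then show "measure_pmf.expectation ?G (\<lambda>E. of_bool (?P x E)) = measure_pmf.prob ?G {E. ?P x E}"
      by (simp add: measure_pmf.emeasure_eq_measure)
  qed simp
  finally show ?thesis by (simp add: case_prod_unfold)
qed

section \<open>Numbers of tuples of distinct nodes\<close>

text \<open>Falling factorial with real subtraction: for \<open>n < 3\<close> one of the factors is
  0, so no case distinction arises.\<close>

lemma binomial_3_real: "6 * real (n choose 3) = real n * (real n - 1) * (real n - 2)"
proof -
  have "fact 3 * (real n gchoose 3) = (\<Prod>i = 0..<3. real n - real i)"
    using gbinomial_mult_fact[of 3 "real n"] by simp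
  then show ?thesis
    by (simp add: binomial_gbinomial numeral_eq_Suc algebra_simps)
qed

lemma binomial_4_real: "24 * real (n choose 4) = real n * (real n - 1) * (real n - 2) * (real n - 3)"
proof -
  have "fact 4 * (real n gchoose 4) = (\<Prod>i = 0..<4. real n - real i)"
    using gbinomial_mult_fact[of 4 "real n"] by simp
  then show ?thesis
    by (simp add: binomial_gbinomial numeral_eq_Suc algebra_simps)
qed

lemma card_distinct_triples:
  "real (card {(i, j, l). {i, j, l} \<subseteq> {1..n} \<and> distinct [i, j, l]}) = 6 * real (n choose 3)"
proof -
  have "{(i, j, l). {i, j, l} \<subseteq> {1..n} \<and> distinct [i, j, l]} =
    (SIGMA i:{1..n}. SIGMA j:{1..n} - {i}. {1..n} - {i, j})" by auto
  also have "card \<dots> = n * ((n - 1) * (n - 2))"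
    by (simp add: card_Diff_subset numeral_eq_Suc)
  also have "real \<dots> = 6 * real (n choose 3)"
  \<comment> \<open>Below 2 the truncated subtractions need not agree with the real ones, but both
    sides are 0.\<close>
  proof (cases "n \<ge> 2")
    case False
    then have "n = 0 \<or> n = 1" by auto
    then show ?thesis by auto
  qed (simp add: binomial_3_real of_nat_diff)
  finally show ?thesis .
qed

lemma card_distinct_quadruples:
  "real (card {(i, j, k, l). {i, j, k, l} \<subseteq> {1..n} \<and> distinct [i, j, k, l]}) = 24 * real (n choose 4)"
proof -
  have "{(i, j, k, l). {i, j, k, l} \<subseteq> {1..n} \<and> distinct [i, j, k, l]} =
    (SIGMA i:{1..n}. SIGMA j:{1..n} - {i}. SIGMA k:{1..n} - {i, j}. {1..n} - {i, j, k})" by auto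
  also have "card \<dots> = n * ((n - 1) * ((n - 2) * (n - 3)))"
    by (simp add: card_Diff_subset numeral_eq_Suc)
  also have "real \<dots> = 24 * real (n choose 4)"
  proof (cases "n \<ge> 3")
    case False
    then have "n = 0 \<or> n = 1 \<or> n = 2" by auto
    then show ?thesis by auto
  qed (simp add: binomial_4_real of_nat_diff)
  finally show ?thesis .
qed

text \<open>The quadruples split into disjoint arcs (\<open>S\<close>), common tails
  (\<open>T1\<close>), common heads (\<open>T2\<close>), paths in either order (\<open>T3\<close>,
  \<open>T4\<close>) and degenerate ones. Tails with heads, and the two orders of paths, each
  account for \<open>12 * (n choose 3)\<close> quadruples; halving gives the coefficients 12 and
  6.\<close>

lemma expected_edges_eq:
  assumes q: "0 \<le> q" "q \<le> 1"
  shows "expected_edges n q =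
    12 * real (n choose 4) * q\<^sup>2 * (1 - q\<^sup>2)
    + 6 * real (n choose 3) * q\<^sup>2 * (1 + (1 - q) * (1 - q\<^sup>2) ^ (n - 3))"
proof -
  let ?V = "{1..n}"
  define Q where "Q = {(i, j, k, l). {i, j, k, l} \<subseteq> ?V \<and> i \<noteq> j \<and> k \<noteq> l}"
  define S where "S = {(i, j, k, l). {i, j, k, l} \<subseteq> ?V \<and> distinct [i, j, k, l]}"
  define T where "T = {(i, j, l). {i, j, l} \<subseteq> ?V \<and> distinct [i, j, l]}"
  define T1 where "T1 = (\<lambda>(i, j, l). (i, j, i, l)) ` T"
  define T2 where "T2 = (\<lambda>(i, j, l). (j, i, l, i)) ` T"
  define T3 where "T3 = (\<lambda>(i, j, l). (i, j, j, l)) ` T"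
  \<comment> \<open>The paths of \<open>T3\<close> with their two arcs listed in the opposite
    order.\<close>
  define T4 where "T4 = (\<lambda>(i, j, l). (j, l, i, j)) ` T"
  define r where "r = q\<^sup>2 * ((1 - q) * (1 - q\<^sup>2) ^ (n - 3))"
  have "Q \<subseteq> ?V \<times> ?V \<times> ?V \<times> ?V" by (auto simp: Q_def)
  then have fin: "finite Q" by (rule finite_subset) simp
  have sub: "S \<subseteq> Q" "T1 \<subseteq> Q" "T2 \<subseteq> Q" "T3 \<subseteq> Q" "T4 \<subseteq> Q"
    by (auto simp: S_def T_def T1_def T2_def T3_def T4_def Q_def)
  have mem: "(i, j, k, l) \<in> S \<longleftrightarrow> {i, j, k, l} \<subseteq> ?V \<and> distinct [i, j, k, l]"
    "(i, j, k, l) \<in> T1 \<longleftrightarrow> i = k \<and> {i, j, l} \<subseteq> ?V \<and> distinct [i, j, l]"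
    "(i, j, k, l) \<in> T2 \<longleftrightarrow> j = l \<and> {i, j, k} \<subseteq> ?V \<and> distinct [i, j, k]"
    "(i, j, k, l) \<in> T3 \<longleftrightarrow> j = k \<and> {i, j, l} \<subseteq> ?V \<and> distinct [i, j, l]"
    "(i, j, k, l) \<in> T4 \<longleftrightarrow> i = l \<and> {i, j, k} \<subseteq> ?V \<and> distinct [i, j, k]" for i j k l
    by (auto simp: S_def T_def T1_def T2_def T3_def T4_def image_iff simp del: atLeastAtMost_iff)
  have pointwise: "prob_exposed n q i j k l =
      of_bool ((i, j, k, l) \<in> S) * (q\<^sup>2 * (1 - q\<^sup>2)) +
      of_bool ((i, j, k, l) \<in> T1) * q\<^sup>2 + of_bool ((i, j, k, l) \<in> T2) * q\<^sup>2 +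
      of_bool ((i, j, k, l) \<in> T3) * r + of_bool ((i, j, k, l) \<in> T4) * r"
    if "(i, j, k, l) \<in> Q" for i j k l
  proof -
    have V: "{i, j, k, l} \<subseteq> ?V" and ne: "i \<noteq> j" "k \<noteq> l" using that by (auto simp: Q_def)
    \<comment> \<open>The second and third cases, equal and opposite generators, belong to none of
      the five classes and have probability 0.\<close>
    consider "distinct [i, j, k, l]" | "i = k" "j = l" | "i = l" "j = k" | "i = k" "j \<noteq> l"
      | "j = l" "i \<noteq> k" | "j = k" "i \<noteq> l" | "i = l" "j \<noteq> k" using ne by auto
    then show ?thesis
    proof cases
      case 1
      then show ?thesis using prob_exposed_disjoint[OF q V 1] V by (auto simp: mem)
    next
      case 2
      then have "\<not> exposed_pair ?V E (arc_vec i j) (arc_vec k l)" for E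
        by (simp add: exposed_pair_def)
      then show ?thesis using 2 ne by (simp add: mem)
    next
      case 3
      then have "\<not> exposed_pair ?V E (arc_vec i j) (arc_vec k l)" for E
        using not_exposed_opposite[of ?V E "arc_vec i j"] by (simp add: arc_vec_uminus)
      then show ?thesis using 3 ne by (simp add: mem)
    next
      case 4
      then show ?thesis using prob_exposed_common_tail[OF q, of i j l n] V ne by (auto simp: mem)
    next
      case 5
      then show ?thesis using prob_exposed_common_head[OF q, of j i k n] V ne by (auto simp: mem)
    next
      case 6
      then show ?thesis using prob_exposed_path[OF q, of i j l n] V ne by (auto simp: mem r_def)
    next
      case 7
      then show ?thesis
        using prob_exposed_path[OF q, of k i j n] V ne
          exposed_pair_commute[of ?V _ "arc_vec i j" "arc_vec k i"] by (auto simp: mem r_def)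
    qed
  qed
  have count: "(\<Sum>x\<in>Q. of_bool (x \<in> X) * c) = real (card X) * c" if "X \<subseteq> Q" for X and c :: real
    using that fin by (simp add: sum_of_bool_eq Int_absorb1 Collect_mem_eq flip: sum_distrib_right)
  have cards: "card T1 = card T" "card T2 = card T" "card T3 = card T" "card T4 = card T"
    unfolding T1_def T2_def T3_def T4_def by (auto intro!: card_image inj_onI)
  have "2 * expected_edges n q = (\<Sum>(i, j, k, l)\<in>Q. prob_exposed n q i j k l)"
    unfolding Q_def by (rule twice_expected_edges)
  also have "\<dots> = (\<Sum>x\<in>Q. of_bool (x \<in> S) * (q\<^sup>2 * (1 - q\<^sup>2)) + of_bool (x \<in> T1) * q\<^sup>2 +
      of_bool (x \<in> T2) * q\<^sup>2 + of_bool (x \<in> T3) * r + of_bool (x \<in> T4) * r)"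
    by (rule sum.cong) (use pointwise in auto)
  also have "\<dots> = real (card S) * (q\<^sup>2 * (1 - q\<^sup>2)) + real (card T) * q\<^sup>2 + real (card T) * q\<^sup>2 +
      real (card T) * r + real (card T) * r"
    by (simp only: sum.distrib count sub cards)
  also have "real (card S) = 24 * real (n choose 4)"
    unfolding S_def by (rule card_distinct_quadruples)
  also have "real (card T) = 6 * real (n choose 3)"
    unfolding T_def by (rule card_distinct_triples)
  finally show ?thesis by (simp add: r_def algebra_simps)
qed

section \<open>Asymptotics\<close>

lemma same_orderI:
  assumes "0 < c" "\<forall>\<^sub>F n in sequentially. 0 < b n \<and> c * b n \<le> a n \<and> a n \<le> C * b n"
  shows "same_order a b"
proof -
  have *: "\<forall>\<^sub>F n in sequentially. c \<le> \<bar>a n / b n\<bar> \<and> \<bar>a n / b n\<bar> \<le> C"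
    using assms(2)
  proof eventually_elim
    case (elim n)
    then have "c \<le> a n / b n" "a n / b n \<le> C" by (simp_all add: field_simps)
    then show ?case using assms(1) by linarith
  qed
  have "ereal c \<le> liminf (\<lambda>n. ereal \<bar>a n / b n\<bar>)"
    using * by (intro Liminf_bounded) (auto elim: eventually_mono)
  moreover have "limsup (\<lambda>n. ereal \<bar>a n / b n\<bar>) \<le> ereal C"
    using * by (intro Limsup_bounded) (auto elim: eventually_mono)
  ultimately show ?thesis
    unfolding same_order_def using assms(1)
    using less_le_trans[of 0 "ereal c"] le_less_trans[of _ "ereal C" "\<infinity>"] by simp
qed

lemma much_lessD:
  assumes "much_less a b"
  shows "\<forall>\<^sub>F n in sequentially. \<bar>a n / b n\<bar> < 1"
proof -
  have "limsup (\<lambda>n. ereal \<bar>a n / b n\<bar>) < 1" using assms by (simp add: much_less_def)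
  then show ?thesis by (drule_tac Limsup_lessD) simp
qed

lemma at_least_orderD:
  assumes "at_least_order a b"
  obtains c where "0 < c" "\<forall>\<^sub>F n in sequentially. c < \<bar>a n / b n\<bar>"
proof -
  obtain c where c: "0 < ereal c" "ereal c < liminf (\<lambda>n. ereal \<bar>a n / b n\<bar>)"
    using assms unfolding at_least_order_def by (blast dest: ereal_dense2)
  show ?thesis using that[of c] c(1) less_LiminfD[OF c(2)] by simp
qed

lemma much_greater_iff:
  "much_greater a b \<longleftrightarrow> filterlim (\<lambda>n. \<bar>a n / b n\<bar>) at_top sequentially"
  unfolding much_greater_def
  by (simp add: Liminf_PInfty[symmetric] tendsto_PInfty_eq_at_top)

section \<open>Order of growth of the expectation\<close>

text \<open>After factoring \<open>1 - q\<^sup>2 = (1 - q) * (1 + q)\<close>, both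
  \<open>1 + q\<close> and \<open>1 + s\<close> lie between 1 and 2, so only the binomials need to
  be compared with powers of \<open>n\<close>.\<close>

lemma expected_edges_bounds:
  assumes n: "n \<ge> 4" and q: "0 < q" "q < 1"
  defines "g \<equiv> real n ^ 4 * q\<^sup>2 * (1 - q) + real n ^ 3 * q\<^sup>2"
  shows "3/64 * g \<le> expected_edges n q" "expected_edges n q \<le> 2 * g"
proof -
  define x where "x = real n"
  have x: "x \<ge> 4" using n by (simp add: x_def)
  define P Q where "P = 12 * real (n choose 4)" and "Q = 6 * real (n choose 3)"
  have P_eq: "2 * P = x * (x - 1) * (x - 2) * (x - 3)" and Q_eq: "Q = x * (x - 1) * (x - 2)"
    using binomial_4_real[of n] binomial_3_real[of n] by (simp_all add: P_def Q_def x_def)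
  \<comment> \<open>From \<open>x \<ge> 4\<close>, the factors \<open>x - 1\<close>,
    \<open>x - 2\<close>, \<open>x - 3\<close> are at least \<open>3/4 * x\<close>,
    \<open>1/2 * x\<close>, \<open>1/4 * x\<close>. Halving the second product gives the constant
    3/64.\<close>
  have "x * (3/4 * x) * (1/2 * x) \<le> Q" "x * (3/4 * x) * (1/2 * x) * (1/4 * x) \<le> 2 * P"
    unfolding P_eq Q_eq by (intro mult_mono; use x in simp)+
  moreover have "Q \<le> x * x * x" "2 * P \<le> x * x * x * x"
    unfolding P_eq Q_eq by (intro mult_mono; use x in simp)+
  ultimately have Q: "3/8 * x ^ 3 \<le> Q" "Q \<le> x ^ 3" and P: "3/64 * x ^ 4 \<le> P" "P \<le> x ^ 4 / 2"
    by (simp_all add: power3_eq_cube power4_eq_xxxx mult_ac)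
  have q2: "q\<^sup>2 \<le> 1" using q by (simp add: power_le_one)
  define s where "s = (1 - q) * (1 - q\<^sup>2) ^ (n - 3)"
  have "(1 - q\<^sup>2) ^ (n - 3) \<le> 1" using q2 by (intro power_le_one) auto
  then have s: "0 \<le> s" "s \<le> 1"
    using q q2 by (auto simp: s_def intro: mult_le_one)
  have E: "expected_edges n q = P * q\<^sup>2 * (1 - q) * (1 + q) + Q * q\<^sup>2 * (1 + s)"
    using expected_edges_eq[of q n] q
    by (simp add: P_def Q_def s_def power2_eq_square algebra_simps)
  have PQ: "0 \<le> P" "0 \<le> Q" by (simp_all add: P_def Q_def)
  have "3/64 * x ^ 4 * q\<^sup>2 * (1 - q) * 1 \<le> P * q\<^sup>2 * (1 - q) * (1 + q)"
    using P q PQ by (intro mult_mono) auto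
  \<comment> \<open>The available constant 3/8 is weakened to 3/64 to match the other
    summand.\<close>
  moreover have "3/64 * x ^ 3 * q\<^sup>2 * 1 \<le> Q * q\<^sup>2 * (1 + s)"
    using Q s PQ x by (intro mult_mono) auto
  moreover have "3/64 * g = 3/64 * x ^ 4 * q\<^sup>2 * (1 - q) * 1 + 3/64 * x ^ 3 * q\<^sup>2 * 1"
    by (simp add: g_def x_def distrib_left mult.assoc)
  ultimately show "3/64 * g \<le> expected_edges n q"
    unfolding E by linarith
  have "P * q\<^sup>2 * (1 - q) * (1 + q) \<le> x ^ 4 / 2 * q\<^sup>2 * (1 - q) * 2"
    using P q PQ x by (intro mult_mono) auto
  also have "\<dots> \<le> 2 * (x ^ 4 * q\<^sup>2 * (1 - q))" using x q by simp
  finally have "P * q\<^sup>2 * (1 - q) * (1 + q) \<le> 2 * (x ^ 4 * q\<^sup>2 * (1 - q))" .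
  moreover have "Q * q\<^sup>2 * (1 + s) \<le> x ^ 3 * q\<^sup>2 * 2"
    using Q s PQ x by (intro mult_mono) auto
  ultimately show "expected_edges n q \<le> 2 * g"
    unfolding E g_def x_def[symmetric] distrib_left by (simp add: add_mono)
qed

text \<open>With \<open>s n = n\<^sup>2 * p n\<close>, the expectation is at most
  \<open>4 * (s n)\<^sup>2\<close>. It is at least of order \<open>(s n)\<^sup>2\<close> while
  \<open>p n \<le> 1/2\<close>; for larger \<open>p n\<close> it grows at least linearly in
  \<open>n\<close> in any case.\<close>

lemma expected_edges_at_top_iff:
  assumes p: "\<And>n. n \<ge> 1 \<Longrightarrow> 0 < p n \<and> p n < (1::real)"
  shows "filterlim (\<lambda>n. expected_edges n (p n)) at_top sequentially \<longleftrightarrow>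
    much_greater p (\<lambda>n. 1 / (real n)\<^sup>2)"
proof -
  define s where "s n = real n ^ 2 * p n" for n
  have s_nonneg: "0 \<le> s n" for n
    using p[of n] by (cases "n = 0") (auto simp: s_def less_imp_le)
  \<comment> \<open>At \<open>n = 0\<close> both sides are 0, the left one because division by 0
    yields 0.\<close>
  have "\<bar>p n / (1 / (real n)\<^sup>2)\<bar> = s n" for n
    using s_nonneg[of n] by (simp add: s_def mult.commute)
  then have mg: "much_greater p (\<lambda>n. 1 / (real n)\<^sup>2) \<longleftrightarrow> filterlim s at_top sequentially"
    unfolding much_greater_iff by simp
  have bounds: "3/64 * min ((s n)\<^sup>2 / 2) (real n / 4) \<le> expected_edges n (p n)"
    "expected_edges n (p n) \<le> 4 * (s n)\<^sup>2" if n: "n \<ge> 4" for n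
  proof -
    let ?g = "real n ^ 4 * (p n)\<^sup>2 * (1 - p n) + real n ^ 3 * (p n)\<^sup>2"
    have pn: "0 < p n" "p n < 1" using p[of n] n by auto
    have s2: "(s n)\<^sup>2 = real n ^ 4 * (p n)\<^sup>2"
      by (simp add: s_def power_mult_distrib flip: power_mult)
    have "real n ^ 4 * (p n)\<^sup>2 * (1 - p n) \<le> (s n)\<^sup>2 * 1"
      unfolding s2 using pn by (intro mult_left_mono) auto
    moreover have "real n ^ 3 * (p n)\<^sup>2 \<le> (s n)\<^sup>2"
      unfolding s2 using n by (intro mult_right_mono power_increasing) auto
    ultimately have "2 * ?g \<le> 2 * ((s n)\<^sup>2 * 1 + (s n)\<^sup>2)"
      by (intro mult_left_mono add_mono) auto
    with expected_edges_bounds(2)[OF n pn]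
    show "expected_edges n (p n) \<le> 4 * (s n)\<^sup>2" by simp
    have "min ((s n)\<^sup>2 / 2) (real n / 4) \<le> ?g"
    proof (cases "p n \<le> 1/2")
      case True
      have "(s n)\<^sup>2 * (1/2) \<le> real n ^ 4 * (p n)\<^sup>2 * (1 - p n)"
        unfolding s2 using True by (intro mult_left_mono) auto
      moreover have "0 \<le> real n ^ 3 * (p n)\<^sup>2" by simp
      ultimately show ?thesis by linarith
    next
      case False
      \<comment> \<open>Weakening \<open>n ^ 3\<close> to \<open>n\<close> is harmless, since only
        divergence matters.\<close>
      have "real n ^ 1 * (1/2)\<^sup>2 \<le> real n ^ 3 * (p n)\<^sup>2"
        using False n by (intro mult_mono power_increasing power_mono) auto
      moreover have "0 \<le> real n ^ 4 * (p n)\<^sup>2 * (1 - p n)" using pn by simp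
      ultimately show ?thesis by (simp add: power2_eq_square)
    qed
    then have "3/64 * min ((s n)\<^sup>2 / 2) (real n / 4) \<le> 3/64 * ?g"
      by (rule mult_left_mono) simp
    then show "3/64 * min ((s n)\<^sup>2 / 2) (real n / 4) \<le> expected_edges n (p n)"
      using expected_edges_bounds(1)[OF n pn] by (rule order_trans)
  qed
  show ?thesis
    unfolding mg
  proof
    assume E: "filterlim (\<lambda>n. expected_edges n (p n)) at_top sequentially"
    show "filterlim s at_top sequentially"
      unfolding filterlim_at_top
    proof
      fix Z
      have "\<forall>\<^sub>F n in sequentially. 4 * Z\<^sup>2 \<le> expected_edges n (p n)"
        using E by (simp add: filterlim_at_top)
      with eventually_ge_at_top[of 4] show "\<forall>\<^sub>F n in sequentially. Z \<le> s n"
      proof eventually_elim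
        case (elim n)
        then have "Z\<^sup>2 \<le> (s n)\<^sup>2" using bounds(2)[of n] by linarith
        then show ?case using s_nonneg power2_le_imp_le by blast
      qed
    qed
  next
    assume "filterlim s at_top sequentially"
    then have "filterlim (\<lambda>n. (s n)\<^sup>2) at_top sequentially"
      by (rule filterlim_pow_at_top[OF pos2])
    show "filterlim (\<lambda>n. expected_edges n (p n)) at_top sequentially"
      unfolding filterlim_at_top
    proof
      fix Z
      \<comment> \<open>The minimum must reach \<open>64/3 * Z\<close> to cancel the factor 3/64;
        its terms \<open>(s n)\<^sup>2 / 2\<close> and \<open>n / 4\<close> then require 128/3 and
        256/3.\<close>
      have "\<forall>\<^sub>F n in sequentially. 128/3 * Z \<le> (s n)\<^sup>2"
        using \<open>filterlim (\<lambda>n. (s n)\<^sup>2) at_top sequentially\<close> unfolding filterlim_at_top by blast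
      moreover have "\<forall>\<^sub>F n in sequentially. 256/3 * Z \<le> real n"
        using filterlim_real_sequentially unfolding filterlim_at_top by blast
      ultimately show "\<forall>\<^sub>F n in sequentially. Z \<le> expected_edges n (p n)"
        using eventually_ge_at_top[of 4]
      proof eventually_elim
        case (elim n)
        then have "64/3 * Z \<le> min ((s n)\<^sup>2 / 2) (real n / 4)" by simp
        then show ?case using bounds(1)[of n] elim by linarith
      qed
    qed
  qed
qed

theorem theorem3p1:
  fixes p :: "nat \<Rightarrow> real"
  assumes "\<And>n. n \<ge> 1 \<Longrightarrow> 0 < p n \<and> p n < 1"
  shows
    "(\<forall>n\<ge>1. expected_edges n (p n) =
       12 * real (n choose 4) * (p n)\<^sup>2 * (1 - (p n)\<^sup>2)
       + 6 * real (n choose 3) * (p n)\<^sup>2 * (1 + (1 - p n) * (1 - (p n)\<^sup>2) ^ (n - 3))) \<and>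
    same_order (\<lambda>n. expected_edges n (p n))
       (\<lambda>n. real n ^ 4 * (p n)\<^sup>2 * (1 - p n) + real n ^ 3 * (p n)\<^sup>2) \<and>
    (much_less (\<lambda>n. 1 - p n) (\<lambda>n. 1 / real n) \<longrightarrow>
       same_order (\<lambda>n. real n ^ 4 * (p n)\<^sup>2 * (1 - p n) + real n ^ 3 * (p n)\<^sup>2)
         (\<lambda>n. real n ^ 3 * (p n)\<^sup>2) \<and>
       same_order (\<lambda>n. expected_edges n (p n)) (\<lambda>n. real n ^ 3 * (p n)\<^sup>2)) \<and>
    (at_least_order (\<lambda>n. 1 - p n) (\<lambda>n. 1 / real n) \<longrightarrow>
       same_order (\<lambda>n. real n ^ 4 * (p n)\<^sup>2 * (1 - p n) + real n ^ 3 * (p n)\<^sup>2)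
         (\<lambda>n. real n ^ 4 * (p n)\<^sup>2 * (1 - p n)) \<and>
       same_order (\<lambda>n. expected_edges n (p n)) (\<lambda>n. real n ^ 4 * (p n)\<^sup>2 * (1 - p n))) \<and>
    (filterlim (\<lambda>n. expected_edges n (p n)) at_top sequentially \<longleftrightarrow>
       much_greater p (\<lambda>n. 1 / (real n)\<^sup>2))"
proof -
  let ?E = "\<lambda>n. expected_edges n (p n)"
  let ?f = "\<lambda>n. real n ^ 4 * (p n)\<^sup>2 * (1 - p n)"
  let ?h = "\<lambda>n. real n ^ 3 * (p n)\<^sup>2"
  have large: "\<forall>\<^sub>F n in sequentially. 0 < n \<and> 0 < ?f n \<and> 0 < ?h n \<and>
      3/64 * (?f n + ?h n) \<le> ?E n \<and> ?E n \<le> 2 * (?f n + ?h n)"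
    using eventually_ge_at_top[of 4]
  proof eventually_elim
    case (elim n)
    then have "0 < p n" "p n < 1" using assms[of n] by auto
    then show ?case using elim expected_edges_bounds[of n "p n"] by simp
  qed
  \<comment> \<open>The ratio of the two summands is \<open>(1 - p n) * n\<close>, exactly what the
    two regimes compare with 1.\<close>
  have fh: "?f n = ((1 - p n) * real n) * ?h n" for n
    by (simp add: power_numeral_reduce)
  \<comment> \<open>Handles both regimes at once: \<open>b\<close> is the dominant summand, and
    whatever bounds the sum in terms of \<open>b\<close> also bounds the expectation.\<close>
  have dominated: "same_order (\<lambda>n. ?f n + ?h n) b \<and> same_order ?E b"
    if b: "\<forall>\<^sub>F n in sequentially. 0 < b n \<and> b n \<le> ?f n + ?h n \<and> ?f n + ?h n \<le> C * b n" for b C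
  proof
    show "same_order (\<lambda>n. ?f n + ?h n) b"
      using b by (intro same_orderI[of 1]) (auto elim: eventually_mono)
    have "\<forall>\<^sub>F n in sequentially. 0 < b n \<and> 3/64 * b n \<le> ?E n \<and> ?E n \<le> 2 * C * b n"
      using b large
    proof eventually_elim
      case (elim n)
      then have "2 * (?f n + ?h n) \<le> 2 * (C * b n)" "3/64 * b n \<le> 3/64 * (?f n + ?h n)"
        by (intro mult_left_mono; simp)+
      then show ?case using elim by simp
    qed
    then show "same_order ?E b" by (intro same_orderI[of "3/64"]) auto
  qed
  have order: "same_order ?E (\<lambda>n. ?f n + ?h n)"
    using large by (intro same_orderI[of "3/64" _ _ 2]) (auto elim!: eventually_mono)
  have dense: "same_order (\<lambda>n. ?f n + ?h n) ?h \<and> same_order ?E ?h"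
    if "much_less (\<lambda>n. 1 - p n) (\<lambda>n. 1 / real n)"
  proof (rule dominated)
    \<comment> \<open>Eventually the ratio in \<open>fh\<close> is at most 1, whence the factor
      2.\<close>
    show "\<forall>\<^sub>F n in sequentially. 0 < ?h n \<and> ?h n \<le> ?f n + ?h n \<and> ?f n + ?h n \<le> 2 * ?h n"
      using large much_lessD[OF that]
    proof eventually_elim
      case (elim n)
      then have "(1 - p n) * real n \<le> 1" by simp
      then have "?f n \<le> 1 * ?h n" unfolding fh using elim by (intro mult_right_mono) auto
      then show ?case using elim by linarith
    qed
  qed
  have not_dense: "same_order (\<lambda>n. ?f n + ?h n) ?f \<and> same_order ?E ?f"
    if at_least: "at_least_order (\<lambda>n. 1 - p n) (\<lambda>n. 1 / real n)"
  proof -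
    obtain c where c: "0 < c" "\<forall>\<^sub>F n in sequentially. c < \<bar>(1 - p n) / (1 / real n)\<bar>"
      using at_least_orderD[OF at_least] by blast
    show ?thesis
    proof (rule dominated)
      \<comment> \<open>A lower bound \<open>c\<close> on the ratio in \<open>fh\<close> makes
        \<open>?h n\<close> at most \<open>1 / c * ?f n\<close>.\<close>
      show "\<forall>\<^sub>F n in sequentially. 0 < ?f n \<and> ?f n \<le> ?f n + ?h n \<and> ?f n + ?h n \<le> (1 + 1 / c) * ?f n"
        using large c(2)
      proof eventually_elim
        case (elim n)
        then have "c \<le> (1 - p n) * real n" using assms[of n] by simp
        then have "c * ?h n \<le> ?f n" unfolding fh using elim by (intro mult_right_mono) auto
        then have "?h n \<le> 1 / c * ?f n" using c(1) by (simp add: field_simps)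
        then show ?case using elim by (simp add: distrib_right)
      qed
    qed
  qed
  have formula: "\<forall>n\<ge>1. ?E n = 12 * real (n choose 4) * (p n)\<^sup>2 * (1 - (p n)\<^sup>2)
       + 6 * real (n choose 3) * (p n)\<^sup>2 * (1 + (1 - p n) * (1 - (p n)\<^sup>2) ^ (n - 3))"
    using assms by (auto intro!: expected_edges_eq less_imp_le)
  show ?thesis
    by (intro conjI impI formula order dense[THEN conjunct1] dense[THEN conjunct2]
        not_dense[THEN conjunct1] not_dense[THEN conjunct2] expected_edges_at_top_iff[OF assms])
qed

end
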